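(* Let $F$ be a field, $n\ge 1$, $m\ge 0$ an integer, and $A\in M_n(F)$. Then $A$ can be written as $A=KW$ with $K\in M_n(F)$ an almost lower triangular matrix with $m$ extra diagonals and $W\in M_n(F)$ an almost upper triangular matrix with $m$ extra diagonals if and only if Algorithm 1 (defined in the context), applied to $A$, produces such a factorization, i.e. its output matrices $L,U$ are such that $K=L$ is almost lower triangular with $m$ extra diagonals, $W=U$ is almost upper triangular with $m$ extra diagonals, and $A=KW$.
   Context: $M_n(F)$ is the set of $n\times n$ matrices over $F$. An $n\times n$ matrix $K=(k_{ij})$ is almost lower triangular with $m$ extra diagonals if $k_{ij}=0$ whenever $j>i+m$. An $n\times n$ matrix $W=(w_{ij})$ is almost upper triangular with $m$ extra diagonals if $w_{ij}=0$ whenever $i>j+m$. Algorithm 1. Input: $A\in M_n(F)$. Set $A^{(1)}=A$. For $k=1,2,\ldots,n$ do the following with the current matrix $A^{(k)}=(a_{ij})$: (i) Search for a nonzero entry of $A^{(k)}$ in this order: for $i=1,\ldots,n$ and, for each $i$, for $j=i,\ldots,n$, first inspect position $(i,j)$, then position $(j,i)$. Let $(p,q)$ be the first inspected position with $a_{pq}\neq 0$, if there is one. (ii) If such a position $(p,q)$ exists, let the $k$-th column of $L$ be the $q$-th column of $A^{(k)}$, and let the $k$-th row of $U$ be $a_{pq}^{-1}$ times the $p$-th row of $A^{(k)}$. If $A^{(k)}=0$, let the $k$-th column of $L$ and the $k$-th row of $U$ both be zero. (iii) Put $A^{(k+1)}=A^{(k)}-(\text{$k$-th column of }L)(\text{$k$-th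 row of }U)$. Output: the $n\times n$ matrices $L$ and $U$. *)

theory Defs
  imports "Jordan_Normal_Form.Matrix"
begin

text \<open>
  Matrix rows and columns are numbered from 0. The two shape conditions only compare a row index
  with a column index, so they are unaffected by this shift.
\<close>

definition almost_lower_triangular :: "nat \<Rightarrow> 'a :: zero mat \<Rightarrow> bool" where
  "almost_lower_triangular m K \<longleftrightarrow>
     (\<forall>i < dim_row K. \<forall>j < dim_col K. j > i + m \<longrightarrow> K $$ (i, j) = 0)"

definition almost_upper_triangular :: "nat \<Rightarrow> 'a :: zero mat \<Rightarrow> bool" where
  "almost_upper_triangular m W \<longleftrightarrow>
     (\<forall>i < dim_row W. \<forall>j < dim_col W. i > j + m \<longrightarrow> W $$ (i, j) = 0)"

definition search_order :: "nat \<Rightarrow> (nat \<times> nat) list" where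
  "search_order n = concat (map (\<lambda>i. concat (map (\<lambda>j. [(i, j), (j, i)]) [i..<n])) [0..<n])"

definition pivot :: "nat \<Rightarrow> 'a :: zero mat \<Rightarrow> (nat \<times> nat) option" where
  "pivot n A = find (\<lambda>(i, j). A $$ (i, j) \<noteq> 0) (search_order n)"

text \<open>
  Every position of an \<open>n \<times> n\<close> matrix occurs in the search order, so the case \<open>None\<close> below is
  exactly the case of the zero matrix.
\<close>

definition pivot_col :: "nat \<Rightarrow> 'a :: field mat \<Rightarrow> 'a vec" where
  "pivot_col n A = (case pivot n A of None \<Rightarrow> 0\<^sub>v n | Some (p, q) \<Rightarrow> col A q)"

definition pivot_row :: "nat \<Rightarrow> 'a :: field mat \<Rightarrow> 'a vec" where
  "pivot_row n A =
     (case pivot n A of None \<Rightarrow> 0\<^sub>v n | Some (p, q) \<Rightarrow> inverse (A $$ (p, q)) \<cdot>\<^sub>v row A p)"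

text \<open>
  \<open>residual n A k\<close> is the current matrix after \<open>k\<close> steps, written \<open>A^(k+1)\<close> when steps are
  numbered from 1. It determines column \<open>k\<close> of \<open>L\<close> and row \<open>k\<close> of \<open>U\<close>, counted from 0.
\<close>

primrec residual :: "nat \<Rightarrow> 'a :: field mat \<Rightarrow> nat \<Rightarrow> 'a mat" where
  "residual n A 0 = A"
| "residual n A (Suc k) =
     residual n A k
       - mat_of_cols n [pivot_col n (residual n A k)] * mat_of_rows n [pivot_row n (residual n A k)]"

definition LU_algorithm :: "nat \<Rightarrow> 'a :: field mat \<Rightarrow> 'a mat \<times> 'a mat" where
  "LU_algorithm n A =
     (mat_of_cols n (map (\<lambda>k. pivot_col n (residual n A k)) [0..<n]),
      mat_of_rows n (map (\<lambda>k. pivot_row n (residual n A k)) [0..<n]))"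

end

theory Submission
  imports Defs
begin

text \<open>
  In a factorization \<open>A = K * W\<close> with \<open>m\<close> extra diagonals, the terms
  \<open>col K k * row W k\<close> with \<open>k \<ge> s + m\<close> vanish on the hook of all positions \<open>(i, j)\<close> with
  \<open>i < s\<close> or \<open>j < s\<close>, so there \<open>A\<close> agrees with a matrix of rank at most \<open>s + m\<close>.
  A step of the algorithm whose pivot lies in the hook is, on the hook, also a Wedderburn
  rank reduction of that matrix, because the search order makes the pivot row or pivot column
  vanish wherever the hook does not determine the other one. After \<open>s + m\<close> steps the hook of the
  residual is therefore zero, which is the required shape of \<open>L\<close> and \<open>U\<close>.
  For \<open>s = n\<close> the hook is the whole matrix, and the same argument shows that the residual after
  \<open>n\<close> steps is zero, that is \<open>A = L * U\<close>.
\<close>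

section \<open>Rank bounds and Wedderburn rank reduction\<close>

text \<open>\<open>B\<close> is a function on all index pairs, free of dimensions. The index set is
  an arbitrary finite set rather than an initial segment, so that one term can be removed without
  renumbering.\<close>

definition rank_le :: "nat \<Rightarrow> (nat \<Rightarrow> nat \<Rightarrow> 'a :: field) \<Rightarrow> bool" where
  "rank_le r B \<longleftrightarrow>
     (\<exists>(S :: nat set) X Y. finite S \<and> card S \<le> r \<and> (\<forall>i j. B i j = (\<Sum>u\<in>S. X i u * Y u j)))"

lemma rank_le_zero_fun: "rank_le r (\<lambda>i j. 0)"
  unfolding rank_le_def by (rule exI[of _ "{}"]) simp

lemma rank_le_0: "rank_le 0 B \<longleftrightarrow> (\<forall>i j. B i j = 0)"
proof
  assume "\<forall>i j. B i j = 0"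
  then have "B = (\<lambda>i j. 0)" by blast
  then show "rank_le 0 B" by (simp add: rank_le_zero_fun)
qed (auto simp: rank_le_def)

text \<open>The subtraction changes only the right factors, from \<open>Y\<close> to
  \<open>Z\<close>. Since row \<open>p\<close> of the difference vanishes, the rows of
  \<open>Z\<close> satisfy a linear relation with coefficients \<open>X p u\<close>. Some
  coefficient \<open>X p t\<close> is nonzero because \<open>B p q\<close> is, so row
  \<open>t\<close> of \<open>Z\<close> can be eliminated and one term disappears.\<close>

lemma rank_le_Wedderburn:
  assumes "rank_le r B" and pq: "B p q \<noteq> 0"
  shows "rank_le (r - 1) (\<lambda>i j. B i j - B i q * (inverse (B p q) * B p j))"
proof -
  obtain S :: "nat set" and X Y where S: "finite S" "card S \<le> r"
    and B: "\<And>i j. B i j = (\<Sum>u\<in>S. X i u * Y u j)"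
    using assms(1) unfolding rank_le_def by blast
  define Z where "Z = (\<lambda>u j. Y u j - Y u q * (inverse (B p q) * B p j))"
  have reduced: "B i j - B i q * (inverse (B p q) * B p j) = (\<Sum>u\<in>S. X i u * Z u j)" for i j
    unfolding Z_def B[of i j] B[of i q]
    by (simp add: right_diff_distrib sum_subtractf sum_distrib_right mult.assoc)
  have "\<exists>t\<in>S. X p t * Y t q \<noteq> 0"
    using pq sum.neutral[of S "\<lambda>t. X p t * Y t q"] unfolding B[of p q] by blast
  then obtain t where t: "t \<in> S" "X p t \<noteq> 0" by auto
  have "(\<Sum>u\<in>S. X p u * Z u j) = 0" for j
    using reduced[of p j] pq by (simp add: field_simps)
  then have *: "X p t * Z t j = - (\<Sum>u\<in>S - {t}. X p u * Z u j)" for j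
    using S(1) t(1) by (simp add: sum.remove add_eq_0_iff2)
  have Zt: "Z t j = - (\<Sum>u\<in>S - {t}. X p u * Z u j) / X p t" for j
    using t(2) by (simp flip: *)
  have "(\<Sum>u\<in>S. X i u * Z u j) = (\<Sum>u\<in>S - {t}. (X i u - X i t * X p u / X p t) * Z u j)" for i j
  proof -
    have split: "(\<Sum>u\<in>S. X i u * Z u j) = X i t * Z t j + (\<Sum>u\<in>S - {t}. X i u * Z u j)"
      using S(1) t(1) by (simp add: sum.remove)
    have Xt: "X i t * Z t j = - (\<Sum>u\<in>S - {t}. X i t * X p u / X p t * Z u j)"
      by (simp add: Zt sum_divide_distrib sum_distrib_left mult.assoc)
    show ?thesis
      unfolding split Xt by (simp add: left_diff_distrib sum_subtractf)
  qed
  then have "\<forall>i j. B i j - B i q * (inverse (B p q) * B p j)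
      = (\<Sum>u\<in>S - {t}. (X i u - X i t * X p u / X p t) * Z u j)"
    by (simp add: reduced)
  moreover have "finite (S - {t})" "card (S - {t}) \<le> r - 1"
    using S t(1) by auto
  ultimately show ?thesis unfolding rank_le_def
    by (intro exI[of _ "S - {t}"] exI[of _ "\<lambda>i u. X i u - X i t * X p u / X p t"] exI[of _ Z] conjI)
qed

section \<open>The search order and the pivot\<close>

lemma find_append: "find P (xs @ ys) = (case find P xs of None \<Rightarrow> find P ys | Some x \<Rightarrow> Some x)"
  by (induction xs) auto

lemma find_concat_upt:
  assumes "find P (concat (map f [a..<b])) = Some z"
  shows "\<exists>i. a \<le> i \<and> i < b \<and> find P (f i) = Some z \<and> (\<forall>k. a \<le> k \<and> k < i \<longrightarrow> (\<forall>x\<in>set (f k). \<not> P x))"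
  using assms
proof (induction b)
  case (Suc b)
  show ?case
  proof (cases "find P (concat (map f [a..<b]))")
    case None
    then have *: "\<forall>k. a \<le> k \<and> k < b \<longrightarrow> (\<forall>x\<in>set (f k). \<not> P x)"
      unfolding find_None_iff by fastforce
    have "a \<le> b" using Suc.prems by (cases "a \<le> b") auto
    moreover have "find P (f b) = Some z"
      using Suc.prems None \<open>a \<le> b\<close> by (simp add: find_append)
    ultimately show ?thesis using * by blast
  next
    case (Some z')
    then have "a \<le> b" by (cases "a \<le> b") auto
    then have "z' = z" using Suc.prems Some by (simp add: find_append)
    then show ?thesis using Suc.IH Some less_SucI by blast
  qed
qed simp

lemma set_search_order: "set (search_order n) = {..<n} \<times> {..<n}"
proof -
  have "(i, j) \<in> set (search_order n)" if "i < n" "j < n" for i j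
  proof (cases "i \<le> j")
    case True
    then have "i \<in> {0..<n}" "j \<in> {i..<n}" using that by auto
    then show ?thesis by (fastforce simp: search_order_def)
  next
    case False
    then have "j \<in> {0..<n}" "i \<in> {j..<n}" using that by auto
    then show ?thesis by (fastforce simp: search_order_def)
  qed
  then show ?thesis by (auto simp: search_order_def)
qed

lemma pivot_None:
  assumes "pivot n A = None" "i < n" "j < n"
  shows "A $$ (i, j) = 0"
  using assms set_search_order[of n] by (auto simp: pivot_def find_None_iff)

text \<open>The search visits positions lexicographically by \<open>(min, max)\<close> of the two
  indices: the outer loop runs through the minimum, the inner loop through the maximum. Both zero
  statements come from \<open>find_concat_upt\<close>, applied once per loop.\<close>

lemma pivot_Some:
  assumes "pivot n A = Some (p, q)"
  shows "p < n" "q < n" "A $$ (p, q) \<noteq> 0"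
    and "\<And>x y. x < n \<Longrightarrow> y < n \<Longrightarrow> min x y < min p q \<Longrightarrow> A $$ (x, y) = 0"
    and "\<And>x y. x < n \<Longrightarrow> y < n \<Longrightarrow> min x y = min p q \<Longrightarrow> max x y < max p q \<Longrightarrow> A $$ (x, y) = 0"
proof -
  let ?P = "\<lambda>(i, j). A $$ (i, j) \<noteq> 0"
  let ?g = "\<lambda>i. concat (map (\<lambda>j. [(i, j), (j, i)]) [i..<n])"
  obtain i where i: "i < n" "find ?P (?g i) = Some (p, q)"
    and before_i: "\<And>k x. k < i \<Longrightarrow> x \<in> set (?g k) \<Longrightarrow> \<not> ?P x"
    using find_concat_upt[OF assms[unfolded pivot_def search_order_def]] by auto
  obtain j where j: "i \<le> j" "j < n" "find ?P [(i, j), (j, i)] = Some (p, q)"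
    and before_j: "\<And>k x. i \<le> k \<Longrightarrow> k < j \<Longrightarrow> x \<in> set [(i, k), (k, i)] \<Longrightarrow> \<not> ?P x"
    using find_concat_upt[OF i(2)] by blast
  have pq: "(p, q) = (i, j) \<or> (p, q) = (j, i)" and nz: "A $$ (p, q) \<noteq> 0"
    using j(3) by (auto split: if_splits)
  then show "p < n" "q < n" "A $$ (p, q) \<noteq> 0"
    using i(1) j(2) by auto
  have mm: "min p q = i" "max p q = j" using pq j(1) by auto
  show "A $$ (x, y) = 0" if "x < n" "y < n" "min x y < min p q" for x y
  proof -
    have "(x, y) \<in> set (?g (min x y))"
      using that by (cases "x \<le> y") auto
    then show ?thesis using before_i[of "min x y" "(x, y)"] that mm by auto
  qed
  show "A $$ (x, y) = 0" if "x < n" "y < n" "min x y = min p q" "max x y < max p q" for x y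
  proof -
    have "(x, y) \<in> set [(i, max x y), (max x y, i)]"
      using that mm by (cases "x \<le> y") auto
    moreover have "i \<le> max x y" using that mm by linarith
    ultimately show ?thesis using before_j[of "max x y" "(x, y)"] that mm by auto
  qed
qed

section \<open>Residuals and the hook invariant\<close>

lemma residual_carrier: "A \<in> carrier_mat n n \<Longrightarrow> residual n A k \<in> carrier_mat n n"
  by (induction k) auto

lemma residual_Suc_index:
  assumes "A \<in> carrier_mat n n" "i < n" "j < n"
  shows "residual n A (Suc k) $$ (i, j) =
    residual n A k $$ (i, j) - pivot_col n (residual n A k) $ i * pivot_row n (residual n A k) $ j"
  using assms residual_carrier[OF assms(1), of k]
  by (simp add: scalar_prod_def mat_of_cols_index mat_of_rows_index)

lemma residual_index:
  assumes "A \<in> carrier_mat n n" "i < n" "j < n"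
  shows "residual n A k $$ (i, j) = A $$ (i, j)
    - (\<Sum>u<k. pivot_col n (residual n A u) $ i * pivot_row n (residual n A u) $ j)"
proof (induction k)
  case (Suc k)
  then show ?case unfolding residual_Suc_index[OF assms] by simp
qed simp

text \<open>Outside the hook \<open>B\<close> is free, so this is a low-rank completion property of
  the hook entries. For \<open>s = n\<close> it bounds the rank of \<open>M\<close>; for
  \<open>r = 0\<close> it says that the hook is zero.\<close>

definition hook_completable :: "nat \<Rightarrow> nat \<Rightarrow> nat \<Rightarrow> 'a :: field mat \<Rightarrow> bool" where
  "hook_completable n s r M \<longleftrightarrow>
     (\<exists>B. rank_le r B \<and> (\<forall>i<n. \<forall>j<n. i < s \<or> j < s \<longrightarrow> M $$ (i, j) = B i j))"

lemma hook_completable_0: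
  "hook_completable n s 0 M \<longleftrightarrow> (\<forall>i<n. \<forall>j<n. i < s \<or> j < s \<longrightarrow> M $$ (i, j) = 0)"
  by (auto simp: hook_completable_def rank_le_0)

lemma hook_completable_zero:
  assumes "\<And>i j. i < n \<Longrightarrow> j < n \<Longrightarrow> i < s \<or> j < s \<Longrightarrow> M $$ (i, j) = 0"
  shows "hook_completable n s r M"
  unfolding hook_completable_def
  using assms rank_le_zero_fun by (intro exI[of _ "\<lambda>i j. 0"]) auto

lemma hook_completable_residual_Suc:
  assumes A: "A \<in> carrier_mat n n" and hook: "hook_completable n s r (residual n A k)"
  shows "hook_completable n s (r - 1) (residual n A (Suc k))"
proof (cases "pivot n (residual n A k)")
  case None
  have "residual n A (Suc k) $$ (i, j) = 0" if "i < n" "j < n" for i j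
    unfolding residual_Suc_index[OF A that]
    using that pivot_None[OF None that] by (simp add: pivot_col_def None)
  then show ?thesis by (intro hook_completable_zero)
next
  case (Some pq)
  obtain p q where "pq = (p, q)" by (cases pq)
  define M where "M = residual n A k"
  have M: "M \<in> carrier_mat n n" using residual_carrier[OF A] by (simp add: M_def)
  have piv: "pivot n M = Some (p, q)" using Some \<open>pq = (p, q)\<close> by (simp add: M_def)
  note pivot = pivot_Some[OF piv]
  have step: "residual n A (Suc k) $$ (i, j) =
      M $$ (i, j) - M $$ (i, q) * (inverse (M $$ (p, q)) * M $$ (p, j))" if "i < n" "j < n" for i j
    unfolding residual_Suc_index[OF A that] M_def[symmetric]
    using that M pivot(1,2) by (simp add: pivot_col_def pivot_row_def piv)
  show ?thesis
  proof (cases "min p q < s")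
    case False
    then have "M $$ (x, y) = 0" if "x < n" "y < n" "x < s \<or> y < s" for x y
    proof -
      have "min x y < min p q" using that False by linarith
      then show ?thesis using pivot(4) that by blast
    qed
    \<comment> \<open>The pivot is outside the hook, so \<open>M\<close> vanishes on it. The
      subtracted product also vanishes there, through its factor in column \<open>q\<close> if
      \<open>i < s\<close> and in row \<open>p\<close> if \<open>j < s\<close>.\<close>
    then show ?thesis
      using pivot(1,2) by (intro hook_completable_zero) (auto simp: step simp del: residual.simps)
  next
    case True
    obtain B where B: "rank_le r B"
      and MB: "\<And>i j. i < n \<Longrightarrow> j < n \<Longrightarrow> i < s \<or> j < s \<Longrightarrow> M $$ (i, j) = B i j"
      using hook unfolding hook_completable_def M_def by blast
    have pq: "M $$ (p, q) = B p q" using MB pivot(1,2) True by (auto simp: min_def split: if_splits)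
    \<comment> \<open>As \<open>min p q < s \<le> q\<close>, the pivot has \<open>p < s\<close>.
      Position \<open>(p, y)\<close> is searched before it: either its minimum is smaller, or the
      minimum is \<open>p\<close> again and \<open>y < q\<close>.\<close>
    have row0: "M $$ (p, y) = 0" if "s \<le> q" "y < s" "y < n" for y
    proof (cases "y < p")
      case True
      then show ?thesis using pivot(4)[of p y] that pivot(1) by auto
    next
      case False
      then show ?thesis using pivot(5)[of p y] that pivot(1) True by auto
    qed
    have col0: "M $$ (x, q) = 0" if "s \<le> p" "x < s" "x < n" for x
    proof (cases "x < q")
      case True
      then show ?thesis using pivot(4)[of x q] that pivot(2) by auto
    next
      case False
      then show ?thesis using pivot(5)[of x q] that pivot(2) True by auto
    qed
    have "M $$ (i, q) * (inverse (M $$ (p, q)) * M $$ (p, j))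
        = B i q * (inverse (B p q) * B p j)"
      if ij: "i < n" "j < n" "i < s \<or> j < s" for i j
    proof -
      \<comment> \<open>In the second case \<open>B i q\<close> is unknown for
        \<open>s \<le> i\<close>, but then \<open>j < s\<close>, and \<open>row0\<close> makes both
        products zero. The third case is the transpose, with \<open>col0\<close>.\<close>
      consider "p < s" "q < s" | "p < s" "s \<le> q" | "s \<le> p" "q < s"
        using True by linarith
      then show ?thesis
      proof cases
        case 1
        then show ?thesis using MB ij pivot(1,2) pq by simp
      next
        case 2
        have "M $$ (p, j) = B p j" using MB 2 pivot(1) ij by simp
        then show ?thesis
          using MB[of i q] row0[of j] 2 ij pivot(2) pq by (cases "j < s") auto
      next
        case 3
        have "M $$ (i, q) = B i q" using MB 3 pivot(2) ij by simp
        then show ?thesis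
          using MB[of p j] col0[of i] 3 ij pivot(1) pq by (cases "i < s") auto
      qed
    qed
    then have "residual n A (Suc k) $$ (i, j) = B i j - B i q * (inverse (B p q) * B p j)"
      if "i < n" "j < n" "i < s \<or> j < s" for i j
      using that MB step by simp
    moreover have "rank_le (r - 1) (\<lambda>i j. B i j - B i q * (inverse (B p q) * B p j))"
      using rank_le_Wedderburn[OF B, of p q] pivot(3) pq by simp
    ultimately show ?thesis unfolding hook_completable_def by blast
  qed
qed

lemma hook_completable_residual:
  assumes "A \<in> carrier_mat n n" "hook_completable n s r A"
  shows "hook_completable n s (r - k) (residual n A k)"
proof (induction k)
  case (Suc k)
  then show ?case using hook_completable_residual_Suc[OF assms(1)] by fastforce
qed (simp add: assms)

lemma index_mult_mat_sum:
  assumes "K \<in> carrier_mat n n" "W \<in> carrier_mat n n" "i < n" "j < n"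
  shows "(K * W) $$ (i, j) = (\<Sum>u<n. K $$ (i, u) * W $$ (u, j))"
  using assms by (simp add: scalar_prod_def atLeast0LessThan)

lemma hook_completable_mult:
  assumes K: "K \<in> carrier_mat n n" "almost_lower_triangular m K"
    and W: "W \<in> carrier_mat n n" "almost_upper_triangular m W"
  shows "hook_completable n s (s + m) (K * W)"
proof -
  \<comment> \<open>The intersection with \<open>{..<n}\<close> covers the case
    \<open>s + m > n\<close>.\<close>
  define S where "S = {..<n} \<inter> {..<s + m}"
  define B where "B = (\<lambda>i j. \<Sum>u\<in>S. K $$ (i, u) * W $$ (u, j))"
  have "card S \<le> s + m"
    unfolding S_def using card_mono[of "{..<s + m}" "{..<n} \<inter> {..<s + m}"] by simp
  then have "rank_le (s + m) B"
    unfolding rank_le_def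
    by (intro exI[of _ S] exI[of _ "\<lambda>i u. K $$ (i, u)"] exI[of _ "\<lambda>u j. W $$ (u, j)"])
      (simp add: B_def S_def)
  moreover have "(K * W) $$ (i, j) = B i j" if "i < n" "j < n" "i < s \<or> j < s" for i j
    unfolding index_mult_mat_sum[OF K(1) W(1) that(1,2)] B_def
  proof (rule sum.mono_neutral_right)
    show "\<forall>u\<in>{..<n} - S. K $$ (i, u) * W $$ (u, j) = 0"
    proof
      fix u assume "u \<in> {..<n} - S"
      then have "u < n" "s + m \<le> u" by (auto simp: S_def)
      then have "K $$ (i, u) = 0 \<or> W $$ (u, j) = 0"
        using that K W by (auto simp: almost_lower_triangular_def almost_upper_triangular_def)
      then show "K $$ (i, u) * W $$ (u, j) = 0" by auto
    qed
  qed (auto simp: S_def)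
  ultimately show ?thesis unfolding hook_completable_def by blast
qed

text \<open>The factorization \<open>1\<^sub>m n * A\<close> has \<open>n\<close> terms, which
  bounds the rank by \<open>n\<close>. With \<open>s = n\<close> the hook is the whole matrix, and
  \<open>n\<close> steps lower the bound to 0.\<close>

lemma residual_n_eq_0:
  assumes A: "A \<in> carrier_mat n n" and "i < n" "j < n"
  shows "residual n A n $$ (i, j) = 0"
proof -
  have "A $$ (x, y) = (\<Sum>u<n. 1\<^sub>m n $$ (x, u) * A $$ (u, y))" if "x < n" "y < n" for x y
    using index_mult_mat_sum[of "1\<^sub>m n" n A x y] A that by simp
  moreover have "rank_le n (\<lambda>x y. \<Sum>u<n. 1\<^sub>m n $$ (x, u) * A $$ (u, y))"
    unfolding rank_le_def
    by (intro exI[of _ "{..<n}"] exI[of _ "\<lambda>x u. 1\<^sub>m n $$ (x, u)"] exI[of _ "\<lambda>u y. A $$ (u, y)"]) simp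
  ultimately have "hook_completable n n n A"
    unfolding hook_completable_def by blast
  from hook_completable_residual[OF A this, of n] show ?thesis
    using assms by (simp add: hook_completable_0)
qed

theorem theorem4:
  fixes A :: "'a :: field mat" and n m :: nat
  assumes "n \<ge> 1" and "A \<in> carrier_mat n n"
  shows "(\<exists>K \<in> carrier_mat n n. \<exists>W \<in> carrier_mat n n.
            almost_lower_triangular m K \<and> almost_upper_triangular m W \<and> A = K * W)
     \<longleftrightarrow>
         (case LU_algorithm n A of (L, U) \<Rightarrow>
            L \<in> carrier_mat n n \<and> U \<in> carrier_mat n n \<and>
            almost_lower_triangular m L \<and> almost_upper_triangular m U \<and> A = L * U)"
proof -
  note A = assms(2)
  define L where "L = mat_of_cols n (map (\<lambda>k. pivot_col n (residual n A k)) [0..<n])"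
  define U where "U = mat_of_rows n (map (\<lambda>k. pivot_row n (residual n A k)) [0..<n])"
  have LU: "LU_algorithm n A = (L, U)" by (simp add: LU_algorithm_def L_def U_def)
  have L: "L \<in> carrier_mat n n" and U: "U \<in> carrier_mat n n" by (auto simp: L_def U_def)
  have L_index: "L $$ (i, k) = pivot_col n (residual n A k) $ i" if "i < n" "k < n" for i k
    using that by (simp add: L_def mat_of_cols_index)
  have U_index: "U $$ (k, j) = pivot_row n (residual n A k) $ j" if "k < n" "j < n" for k j
    using that by (simp add: U_def mat_of_rows_index)
  \<comment> \<open>\<open>L * U\<close> is the sum of all the rank-one terms subtracted in
    \<open>n\<close> steps, and the residual left over is zero.\<close>
  have "A = L * U"
  proof (rule eq_matI)
    fix i j assume "i < dim_row (L * U)" "j < dim_col (L * U)"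
    then have ij: "i < n" "j < n" using L U by auto
    have "(L * U) $$ (i, j)
        = (\<Sum>u<n. pivot_col n (residual n A u) $ i * pivot_row n (residual n A u) $ j)"
      using ij by (simp add: index_mult_mat_sum[OF L U] L_index U_index del: index_mult_mat)
    then show "A $$ (i, j) = (L * U) $$ (i, j)"
      using residual_n_eq_0[OF A ij] by (simp add: residual_index[OF A ij])
  qed (use A L U in auto)
  moreover have "almost_lower_triangular m L \<and> almost_upper_triangular m U"
    if K: "K \<in> carrier_mat n n" "almost_lower_triangular m K"
      and W: "W \<in> carrier_mat n n" "almost_upper_triangular m W" and KW: "A = K * W" for K W
  proof -
    have zero: "residual n A k $$ (x, y) = 0"
      if "k < n" "x < n" "y < n" "x + m < k \<or> y + m < k" for k x y
    proof -
      \<comment> \<open>The hook size is \<open>s = k - m\<close>. The assumption forces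
        \<open>m < k\<close>, so the bound \<open>s + m\<close> equals \<open>k\<close> and is used
        up after \<open>k\<close> steps.\<close>
      have "hook_completable n (k - m) (k - m + m - k) (residual n A k)"
        using hook_completable_residual[OF A] hook_completable_mult[OF K W] KW by blast
      moreover have "k - m + m - k = 0" using that by linarith
      moreover have "x < k - m \<or> y < k - m" using that by linarith
      ultimately show ?thesis using that(2,3) by (simp add: hook_completable_0) blast
    qed
    have R: "residual n A k \<in> carrier_mat n n" for k by (rule residual_carrier[OF A])
    \<comment> \<open>With a pivot \<open>(p, q)\<close>, this entry is the residual entry at
      \<open>(i, q)\<close>, which lies in the zero hook for any \<open>q\<close>. Without a pivot
      it is 0 by definition.\<close>
    have "pivot_col n (residual n A k) $ i = 0" if "k < n" "i + m < k" for i k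
      using that R[of k] zero[of k i] pivot_Some(2)[of n "residual n A k"]
      by (auto simp: pivot_col_def split: option.split)
    moreover have "pivot_row n (residual n A k) $ j = 0" if "k < n" "j + m < k" for j k
      using that R[of k] zero[of k _ j] pivot_Some(1)[of n "residual n A k"]
      by (auto simp: pivot_row_def split: option.split)
    ultimately show ?thesis
      using L U by (auto simp: almost_lower_triangular_def almost_upper_triangular_def
          L_index U_index)
  qed
  ultimately show ?thesis using L U LU by auto
qed

end
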